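(* Let $(S,\|\cdot\|)$ be a complete random normed module over $K$ ($K=\mathbb R$ or $\mathbb C$) with base $(\Omega,\mathcal F,P)$. Then $(S,\|\cdot\|)$ is random uniformly convex if and only if, for each fixed number $p$ with $1<p<+\infty$, the Banach space $(L^p(S),\|\cdot\|_p)$ derived from $S$ is uniformly convex.
   Context: $(\Omega,\mathcal F,P)$ is a probability space. $L^0(\mathcal F,K)$ is the algebra of a.s.-equivalence classes of $K$-valued random variables; $L^0(\mathcal F,\mathbb R)$ is ordered by a.s. inequality; $L^0_+=\{\xi\in L^0(\mathcal F,\mathbb R):\xi\ge0\}$. $\widetilde{\mathcal F}$ is the set of equivalence classes of elements of $\mathcal F$ modulo $P$-null sets (inclusion, intersection etc. modulo null sets); $I_A$ is the class of the indicator of $A\in\widetilde{\mathcal F}$; $[\xi>0]$ is the class of $\{\omega:\xi^0(\omega)>0\}$ for a representative $\xi^0$ of $\xi$. A random normed module $(S,\|\cdot\|)$ over $K$ with base $(\Omega,\mathcal F,P)$ is a left module $S$ over the algebra $L^0(\mathcal F,K)$ with a map $\|\cdot\|:S\to L^0_+$ such that $\|\xi x\|=|\xi|\,\|x\|$ for $\xi\in L^0(\mathcal F,K)$, $\|x+y\|\le\|x\|+\|y\|$, and $\|x\|=0$ implies $x=\theta$ (the null vector). $S$ carries the metrizable linear topology in which $x_n\to x$ iff $\|x_n-x\|\to0$ in probability; completeness is with respect to it. For $x,y\in S$: $A_x=[\|x\|>0]$, $B_{xy}=A_x\cap A_y\cap A_{x-y}$. $U(1)=\{x\in S:\|x\|\le1\}$.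 A complete random normed module $S$ is random uniformly convex if for each real number $\epsilon\in(0,2]$ there is a real number $\delta\in(0,1)$ such that, for all $x,y\in U(1)$ and all $D\in\widetilde{\mathcal F}$ with $D\subset B_{xy}$ and $P(D)>0$, $I_D\|x-y\|\ge\epsilon I_D$ implies $I_D\|x+y\|\le2(1-\delta)I_D$. For $1<p<+\infty$, $L^p(S)=\{x\in S:\|x\|_p<+\infty\}$ where $\|x\|_p=\left(\int_\Omega\|x\|^p\,dP\right)^{1/p}$; this is a Banach space over $K$ when $S$ is complete. *)

theory Defs
  imports "HOL-Probability.Probability" "HOL-Algebra.Module"
begin

section \<open>The algebra of random variables modulo almost sure equality\<close>

text \<open>
  Elements of \<open>L\<^sup>0(F, K)\<close> are honest equivalence classes, i.e. sets of measurable functions. All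
  operations below are defined through representatives and do not depend on their choice, up to
  null sets.
\<close>

definition L0_rel :: "'w measure \<Rightarrow> (('w \<Rightarrow> 'k::topological_space) \<times> ('w \<Rightarrow> 'k)) set" where
  "L0_rel M = {(f, g). f \<in> borel_measurable M \<and> g \<in> borel_measurable M \<and> (AE w in M. f w = g w)}"

definition L0_class :: "'w measure \<Rightarrow> ('w \<Rightarrow> 'k::topological_space) \<Rightarrow> ('w \<Rightarrow> 'k) set" where
  "L0_class M f = L0_rel M `` {f}"

definition rep :: "'a set \<Rightarrow> 'a" where
  "rep X = (SOME f. f \<in> X)"

definition L0 :: "'w measure \<Rightarrow> ('w \<Rightarrow> 'k::real_normed_field) set ring" where
  "L0 M = \<lparr>carrier = borel_measurable M // L0_rel M,
           mult = (\<lambda>\<xi> \<eta>. L0_class M (\<lambda>w. rep \<xi> w * rep \<eta> w)),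
           one = L0_class M (\<lambda>w. 1),
           zero = L0_class M (\<lambda>w. 0),
           add = (\<lambda>\<xi> \<eta>. L0_class M (\<lambda>w. rep \<xi> w + rep \<eta> w))\<rparr>"

definition L0_const :: "'w measure \<Rightarrow> 'k::real_normed_field \<Rightarrow> ('w \<Rightarrow> 'k) set" where
  "L0_const M c = L0_class M (\<lambda>w. c)"

definition L0_abs :: "'w measure \<Rightarrow> ('w \<Rightarrow> 'k::real_normed_field) set \<Rightarrow> ('w \<Rightarrow> real) set" where
  "L0_abs M \<xi> = L0_class M (\<lambda>w. norm (rep \<xi> w))"

definition L0_le :: "'w measure \<Rightarrow> ('w \<Rightarrow> real) set \<Rightarrow> ('w \<Rightarrow> real) set \<Rightarrow> bool" where
  "L0_le M \<xi> \<eta> \<longleftrightarrow> (AE w in M. rep \<xi> w \<le> rep \<eta> w)"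

definition L0_plus :: "'w measure \<Rightarrow> ('w \<Rightarrow> real) set set" where
  "L0_plus M = {\<xi> \<in> carrier (L0 M). L0_le M \<zero>\<^bsub>L0 M\<^esub> \<xi>}"

section \<open>Events modulo null sets\<close>

definition event_rel :: "'w measure \<Rightarrow> ('w set \<times> 'w set) set" where
  "event_rel M = {(A, B). A \<in> sets M \<and> B \<in> sets M \<and> (A - B) \<union> (B - A) \<in> null_sets M}"

definition events_mod :: "'w measure \<Rightarrow> 'w set set set" where
  "events_mod M = sets M // event_rel M"

definition event_class :: "'w measure \<Rightarrow> 'w set \<Rightarrow> 'w set set" where
  "event_class M A = event_rel M `` {A}"

definition event_le :: "'w measure \<Rightarrow> 'w set set \<Rightarrow> 'w set set \<Rightarrow> bool" where
  "event_le M D E \<longleftrightarrow> rep D - rep E \<in> null_sets M"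

definition event_inter :: "'w measure \<Rightarrow> 'w set set \<Rightarrow> 'w set set \<Rightarrow> 'w set set" where
  "event_inter M D E = event_class M (rep D \<inter> rep E)"

definition event_prob :: "'w measure \<Rightarrow> 'w set set \<Rightarrow> real" where
  "event_prob M D = measure M (rep D)"

definition event_ind :: "'w measure \<Rightarrow> 'w set set \<Rightarrow> ('w \<Rightarrow> real) set" where
  "event_ind M D = L0_class M (indicator (rep D))"

definition event_pos :: "'w measure \<Rightarrow> ('w \<Rightarrow> real) set \<Rightarrow> 'w set set" where
  "event_pos M \<xi> = event_class M {w \<in> space M. rep \<xi> w > 0}"

section \<open>Random normed modules\<close>

text \<open>
  A module together with a norm taking values in an arbitrary type. With scalars in
  \<open>L\<^sup>0(F, K)\<close> and norm values in \<open>L\<^sup>0(F, \<real>)\<close> this carries random normed modules, with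
  scalars in \<open>K\<close> and real norm values it carries normed spaces. The fields \<open>mult\<close> and
  \<open>one\<close>, inherited from the record of modules, play no role.
\<close>

record ('r, 's, 'n) normed_module = "('r, 's) module" +
  nrm :: "'s \<Rightarrow> 'n"

type_synonym ('w, 'k, 's) rn_module = "(('w \<Rightarrow> 'k) set, 's, ('w \<Rightarrow> real) set) normed_module"

locale random_normed_module =
  prob_space M + module "L0 M" S
  for M :: "'w measure" and S :: "('w, 'k::real_normed_field, 's) rn_module" +
  assumes nrm_closed: "x \<in> carrier S \<Longrightarrow> nrm S x \<in> L0_plus M"
    and nrm_smult: "\<lbrakk>\<xi> \<in> carrier (L0 M); x \<in> carrier S\<rbrakk>
      \<Longrightarrow> nrm S (\<xi> \<odot>\<^bsub>S\<^esub> x) = L0_abs M \<xi> \<otimes>\<^bsub>L0 M\<^esub> nrm S x"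
    and nrm_triangle: "\<lbrakk>x \<in> carrier S; y \<in> carrier S\<rbrakk>
      \<Longrightarrow> L0_le M (nrm S (x \<oplus>\<^bsub>S\<^esub> y)) (nrm S x \<oplus>\<^bsub>L0 M\<^esub> nrm S y)"
    and nrm_definite: "\<lbrakk>x \<in> carrier S; nrm S x = \<zero>\<^bsub>L0 M\<^esub>\<rbrakk> \<Longrightarrow> x = \<zero>\<^bsub>S\<^esub>"

definition rn_tail_prob :: "'w measure \<Rightarrow> ('w, 'k::real_normed_field, 's) rn_module \<Rightarrow> real \<Rightarrow> 's \<Rightarrow> real" where
  "rn_tail_prob M S e x = measure M {w \<in> space M. rep (nrm S x) w \<ge> e}"

definition rn_tendsto :: "'w measure \<Rightarrow> ('w, 'k::real_normed_field, 's) rn_module \<Rightarrow> (nat \<Rightarrow> 's) \<Rightarrow> 's \<Rightarrow> bool" where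
  "rn_tendsto M S X l \<longleftrightarrow> (\<forall>e>0. (\<lambda>n. rn_tail_prob M S e (X n \<ominus>\<^bsub>S\<^esub> l)) \<longlonglongrightarrow> 0)"

definition rn_Cauchy :: "'w measure \<Rightarrow> ('w, 'k::real_normed_field, 's) rn_module \<Rightarrow> (nat \<Rightarrow> 's) \<Rightarrow> bool" where
  "rn_Cauchy M S X \<longleftrightarrow>
     (\<forall>e>0. \<forall>r>0. \<exists>N. \<forall>m\<ge>N. \<forall>n\<ge>N. rn_tail_prob M S e (X m \<ominus>\<^bsub>S\<^esub> X n) < r)"

text \<open>The linear topology of convergence in probability is metrizable, so sequences suffice.\<close>

locale complete_random_normed_module = random_normed_module +
  assumes complete: "\<lbrakk>range X \<subseteq> carrier S; rn_Cauchy M S X\<rbrakk> \<Longrightarrow> \<exists>l\<in>carrier S. rn_tendsto M S X l"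

definition rn_unit_ball :: "'w measure \<Rightarrow> ('w, 'k::real_normed_field, 's) rn_module \<Rightarrow> 's set" where
  "rn_unit_ball M S = {x \<in> carrier S. L0_le M (nrm S x) \<one>\<^bsub>L0 M\<^esub>}"

definition rn_A :: "'w measure \<Rightarrow> ('w, 'k::real_normed_field, 's) rn_module \<Rightarrow> 's \<Rightarrow> 'w set set" where
  "rn_A M S x = event_pos M (nrm S x)"

definition rn_B :: "'w measure \<Rightarrow> ('w, 'k::real_normed_field, 's) rn_module \<Rightarrow> 's \<Rightarrow> 's \<Rightarrow> 'w set set" where
  "rn_B M S x y = event_inter M (event_inter M (rn_A M S x) (rn_A M S y)) (rn_A M S (x \<ominus>\<^bsub>S\<^esub> y))"

definition random_uniformly_convex :: "'w measure \<Rightarrow> ('w, 'k::real_normed_field, 's) rn_module \<Rightarrow> bool" where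
  "random_uniformly_convex M S \<longleftrightarrow>
     (\<forall>\<epsilon>::real. 0 < \<epsilon> \<and> \<epsilon> \<le> 2 \<longrightarrow>
       (\<exists>\<delta>::real. 0 < \<delta> \<and> \<delta> < 1 \<and>
         (\<forall>x\<in>rn_unit_ball M S. \<forall>y\<in>rn_unit_ball M S. \<forall>D\<in>events_mod M.
            event_le M D (rn_B M S x y) \<and> event_prob M D > 0 \<longrightarrow>
            L0_le M (L0_const M \<epsilon> \<otimes>\<^bsub>L0 M\<^esub> event_ind M D)
                    (event_ind M D \<otimes>\<^bsub>L0 M\<^esub> nrm S (x \<ominus>\<^bsub>S\<^esub> y)) \<longrightarrow>
            L0_le M (event_ind M D \<otimes>\<^bsub>L0 M\<^esub> nrm S (x \<oplus>\<^bsub>S\<^esub> y))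
                    (L0_const M (2 * (1 - \<delta>)) \<otimes>\<^bsub>L0 M\<^esub> event_ind M D))))"

section \<open>The spaces \<open>L\<^sup>p(S)\<close> and uniform convexity\<close>

definition uniformly_convex :: "('k, 's, real) normed_module \<Rightarrow> bool" where
  "uniformly_convex E \<longleftrightarrow>
     (\<forall>\<epsilon>::real. 0 < \<epsilon> \<and> \<epsilon> \<le> 2 \<longrightarrow>
       (\<exists>\<delta>::real. 0 < \<delta> \<and> \<delta> < 1 \<and>
         (\<forall>x\<in>carrier E. \<forall>y\<in>carrier E. nrm E x \<le> 1 \<and> nrm E y \<le> 1 \<and> nrm E (x \<ominus>\<^bsub>E\<^esub> y) \<ge> \<epsilon> \<longrightarrow>
            nrm E (x \<oplus>\<^bsub>E\<^esub> y) \<le> 2 * (1 - \<delta>))))"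

definition Lp_int :: "'w measure \<Rightarrow> ('w, 'k::real_normed_field, 's) rn_module \<Rightarrow> real \<Rightarrow> 's \<Rightarrow> ennreal" where
  "Lp_int M S p x = (\<integral>\<^sup>+ w. ennreal (rep (nrm S x) w powr p) \<partial>M)"

text \<open>The scalars of \<open>L\<^sup>p(S)\<close> act as constant random variables.\<close>

definition Lp_space :: "'w measure \<Rightarrow> ('w, 'k::real_normed_field, 's) rn_module \<Rightarrow> real \<Rightarrow> ('k, 's, real) normed_module" where
  "Lp_space M S p =
     \<lparr>carrier = {x \<in> carrier S. Lp_int M S p x < \<infinity>},
      mult = mult S, one = one S, zero = zero S, add = add S,
      smult = (\<lambda>c x. L0_const M c \<odot>\<^bsub>S\<^esub> x),
      nrm = (\<lambda>x. enn2real (Lp_int M S p x) powr (1 / p))\<rparr>"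

section \<open>Basic facts\<close>

lemma equiv_L0_rel: "equiv (borel_measurable M) (L0_rel M)"
proof (intro equivI refl_onI symI transI)
  fix f g h :: "'a \<Rightarrow> 'b" assume "(f, g) \<in> L0_rel M" "(g, h) \<in> L0_rel M"
  then have "AE w in M. f w = g w" "AE w in M. g w = h w" by (simp_all add: L0_rel_def)
  then have "AE w in M. f w = h w" by eventually_elim simp
  then show "(f, h) \<in> L0_rel M"
    using \<open>(f, g) \<in> L0_rel M\<close> \<open>(g, h) \<in> L0_rel M\<close> by (simp add: L0_rel_def)
next
  fix f g :: "'a \<Rightarrow> 'b" assume "(f, g) \<in> L0_rel M"
  then show "(g, f) \<in> L0_rel M" by (simp add: L0_rel_def eq_commute[of "f _"])
qed (auto simp: L0_rel_def)

lemma L0_class_eqI: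
  assumes "f \<in> borel_measurable M" "g \<in> borel_measurable M" "AE w in M. f w = g w"
  shows "L0_class M f = L0_class M g"
  unfolding L0_class_def using assms
  by (intro equiv_class_eq[OF equiv_L0_rel]) (auto simp: L0_rel_def)

lemma L0_class_closed: "f \<in> borel_measurable M \<Longrightarrow> L0_class M f \<in> carrier (L0 M)"
  by (auto simp: L0_class_def L0_def intro: quotientI)

lemma rep_L0:
  assumes "\<xi> \<in> carrier (L0 M)"
  shows "rep \<xi> \<in> borel_measurable M" "L0_class M (rep \<xi>) = \<xi>"
proof -
  have q: "\<xi> \<in> borel_measurable M // L0_rel M" using assms by (simp add: L0_def)
  then have r: "rep \<xi> \<in> \<xi>"
    using in_quotient_imp_non_empty[OF equiv_L0_rel] by (metis rep_def ex_in_conv someI_ex)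
  then show "rep \<xi> \<in> borel_measurable M"
    using q in_quotient_imp_subset[OF equiv_L0_rel] by blast
  show "L0_class M (rep \<xi>) = \<xi>"
    using q
  proof (rule quotientE)
    fix f assume "\<xi> = L0_rel M `` {f}"
    with r show ?thesis
      using equiv_class_eq[OF equiv_L0_rel, of f "rep \<xi>" M] by (auto simp: L0_class_def)
  qed
qed

lemma rep_L0_class:
  assumes "f \<in> borel_measurable M"
  shows "AE w in M. rep (L0_class M f) w = f w"
proof -
  have "f \<in> L0_class M f" using assms by (auto simp: L0_class_def L0_rel_def)
  then have "rep (L0_class M f) \<in> L0_class M f"
    unfolding rep_def by (rule someI[of "\<lambda>g. g \<in> L0_class M f"])
  then have "(f, rep (L0_class M f)) \<in> L0_rel M"
    unfolding L0_class_def by (rule ImageE) simp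
  then have "AE w in M. f w = rep (L0_class M f) w"
    unfolding L0_rel_def by simp
  then show ?thesis by eventually_elim simp
qed

lemma L0_mult_class:
  fixes f g :: "'w \<Rightarrow> 'k::{real_normed_field, second_countable_topology}"
  assumes [measurable]: "f \<in> borel_measurable M" "g \<in> borel_measurable M"
  shows "L0_class M f \<otimes>\<^bsub>L0 M\<^esub> L0_class M g = L0_class M (\<lambda>w. f w * g w)"
proof -
  have "AE w in M. rep (L0_class M f) w * rep (L0_class M g) w = f w * g w"
    using rep_L0_class[OF assms(1)] rep_L0_class[OF assms(2)] by eventually_elim simp
  then show ?thesis
    unfolding L0_def ring.simps monoid.simps
    by (intro L0_class_eqI borel_measurable_times assms rep_L0(1)[OF L0_class_closed])
qed

lemma L0_add_class:
  fixes f g :: "'w \<Rightarrow> 'k::{real_normed_field, second_countable_topology}"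
  assumes [measurable]: "f \<in> borel_measurable M" "g \<in> borel_measurable M"
  shows "L0_class M f \<oplus>\<^bsub>L0 M\<^esub> L0_class M g = L0_class M (\<lambda>w. f w + g w)"
proof -
  have "AE w in M. rep (L0_class M f) w + rep (L0_class M g) w = f w + g w"
    using rep_L0_class[OF assms(1)] rep_L0_class[OF assms(2)] by eventually_elim simp
  then show ?thesis
    unfolding L0_def ring.simps monoid.simps
    by (intro L0_class_eqI borel_measurable_add assms rep_L0(1)[OF L0_class_closed])
qed

lemma L0_cases:
  assumes "\<xi> \<in> carrier (L0 M)"
  obtains f where "f \<in> borel_measurable M" "\<xi> = L0_class M f"
  using rep_L0[OF assms] by metis

lemma cring_L0:
  "cring (L0 M :: ('w \<Rightarrow> 'k::{real_normed_field, second_countable_topology}) set ring)"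
proof -
  have one: "\<one>\<^bsub>L0 M\<^esub> = L0_class M (\<lambda>w. 1 :: 'k)" and zero: "\<zero>\<^bsub>L0 M\<^esub> = L0_class M (\<lambda>w. 0 :: 'k)"
    by (simp_all add: L0_def)
  note cl = one zero L0_add_class L0_mult_class L0_class_closed
  have comm: "x \<oplus>\<^bsub>L0 M\<^esub> y \<in> carrier (L0 M)" "x \<otimes>\<^bsub>L0 M\<^esub> y \<in> carrier (L0 M)"
    "x \<oplus>\<^bsub>L0 M\<^esub> y = y \<oplus>\<^bsub>L0 M\<^esub> x" "x \<otimes>\<^bsub>L0 M\<^esub> y = y \<otimes>\<^bsub>L0 M\<^esub> x"
    if xy: "x \<in> carrier (L0 M)" "y \<in> carrier (L0 M)" for x y :: "('w \<Rightarrow> 'k) set"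
  proof -
    obtain f where f: "f \<in> borel_measurable M" "x = L0_class M f" using xy(1) by (rule L0_cases)
    obtain g where g: "g \<in> borel_measurable M" "y = L0_class M g" using xy(2) by (rule L0_cases)
    show "x \<oplus>\<^bsub>L0 M\<^esub> y \<in> carrier (L0 M)" "x \<otimes>\<^bsub>L0 M\<^esub> y \<in> carrier (L0 M)"
      using f g by (simp_all add: cl)
    show "x \<oplus>\<^bsub>L0 M\<^esub> y = y \<oplus>\<^bsub>L0 M\<^esub> x" "x \<otimes>\<^bsub>L0 M\<^esub> y = y \<otimes>\<^bsub>L0 M\<^esub> x"
      using f g by (simp_all add: cl add.commute mult.commute)
  qed
  have assoc: "x \<oplus>\<^bsub>L0 M\<^esub> y \<oplus>\<^bsub>L0 M\<^esub> z = x \<oplus>\<^bsub>L0 M\<^esub> (y \<oplus>\<^bsub>L0 M\<^esub> z)"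
    "x \<otimes>\<^bsub>L0 M\<^esub> y \<otimes>\<^bsub>L0 M\<^esub> z = x \<otimes>\<^bsub>L0 M\<^esub> (y \<otimes>\<^bsub>L0 M\<^esub> z)"
    "(x \<oplus>\<^bsub>L0 M\<^esub> y) \<otimes>\<^bsub>L0 M\<^esub> z = x \<otimes>\<^bsub>L0 M\<^esub> z \<oplus>\<^bsub>L0 M\<^esub> y \<otimes>\<^bsub>L0 M\<^esub> z"
    if xyz: "x \<in> carrier (L0 M)" "y \<in> carrier (L0 M)" "z \<in> carrier (L0 M)" for x y z :: "('w \<Rightarrow> 'k) set"
  proof -
    obtain f where f: "f \<in> borel_measurable M" "x = L0_class M f" using xyz(1) by (rule L0_cases)
    obtain g where g: "g \<in> borel_measurable M" "y = L0_class M g" using xyz(2) by (rule L0_cases)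
    obtain h where h: "h \<in> borel_measurable M" "z = L0_class M h" using xyz(3) by (rule L0_cases)
    show "x \<oplus>\<^bsub>L0 M\<^esub> y \<oplus>\<^bsub>L0 M\<^esub> z = x \<oplus>\<^bsub>L0 M\<^esub> (y \<oplus>\<^bsub>L0 M\<^esub> z)"
      using f g h by (simp add: cl add.assoc)
    show "x \<otimes>\<^bsub>L0 M\<^esub> y \<otimes>\<^bsub>L0 M\<^esub> z = x \<otimes>\<^bsub>L0 M\<^esub> (y \<otimes>\<^bsub>L0 M\<^esub> z)"
      using f g h by (simp add: cl mult.assoc)
    show "(x \<oplus>\<^bsub>L0 M\<^esub> y) \<otimes>\<^bsub>L0 M\<^esub> z = x \<otimes>\<^bsub>L0 M\<^esub> z \<oplus>\<^bsub>L0 M\<^esub> y \<otimes>\<^bsub>L0 M\<^esub> z"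
      using f g h by (simp add: cl distrib_right)
  qed
  have unit: "\<zero>\<^bsub>L0 M\<^esub> \<oplus>\<^bsub>L0 M\<^esub> x = x" "\<one>\<^bsub>L0 M\<^esub> \<otimes>\<^bsub>L0 M\<^esub> x = x"
    "\<exists>y\<in>carrier (L0 M). y \<oplus>\<^bsub>L0 M\<^esub> x = \<zero>\<^bsub>L0 M\<^esub>"
    if x: "x \<in> carrier (L0 M)" for x :: "('w \<Rightarrow> 'k) set"
  proof -
    obtain f where f: "f \<in> borel_measurable M" "x = L0_class M f" using x by (rule L0_cases)
    show "\<zero>\<^bsub>L0 M\<^esub> \<oplus>\<^bsub>L0 M\<^esub> x = x" "\<one>\<^bsub>L0 M\<^esub> \<otimes>\<^bsub>L0 M\<^esub> x = x"
      using f by (simp_all add: cl)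
    have "L0_class M (\<lambda>w. - f w) \<oplus>\<^bsub>L0 M\<^esub> x = \<zero>\<^bsub>L0 M\<^esub>"
      using f by (simp add: cl)
    then show "\<exists>y\<in>carrier (L0 M). y \<oplus>\<^bsub>L0 M\<^esub> x = \<zero>\<^bsub>L0 M\<^esub>"
      using f(1) by (intro bexI[of _ "L0_class M (\<lambda>w. - f w)"] L0_class_closed) simp_all
  qed
  have zo: "\<zero>\<^bsub>L0 M\<^esub> \<in> carrier (L0 M :: ('w \<Rightarrow> 'k) set ring)"
    "\<one>\<^bsub>L0 M\<^esub> \<in> carrier (L0 M :: ('w \<Rightarrow> 'k) set ring)"
    by (simp_all add: one zero L0_class_closed)
  show ?thesis
    by (intro cringI abelian_groupI comm_monoidI) (fact comm assoc unit zo)+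
qed

end

theory Submission
  imports Defs
begin

text \<open>
  Both implications rest on the fact that random uniform convexity is a pointwise condition: up to
  null sets it says that one \<open>\<delta>\<close> per \<open>\<epsilon>\<close> bounds \<open>\<parallel>x + y\<parallel>\<close> by \<open>2 (1 - \<delta>)\<close> wherever
  \<open>\<parallel>x - y\<parallel> \<ge> \<epsilon>\<close> (\<open>random_uniformly_convex_iff_AE\<close>).

  Suppose that \<open>S\<close> is random uniformly convex. Dividing by the random variable
  \<open>max \<parallel>x\<parallel> \<parallel>y\<parallel>\<close> carries the pointwise condition from the unit ball to all vectors
  (\<open>random_uniformly_convex_max\<close>). Together with the strict convexity of \<open>t \<mapsto> t\<^sup>p\<close> it yields, for a
  suitable constant \<open>C\<close>, the almost sure inequality
  \<open>C (\<parallel>x + y\<parallel> / 2)\<^sup>p + \<parallel>x - y\<parallel>\<^sup>p \<le> (2 \<epsilon>\<^sup>p + C) (\<parallel>x\<parallel>\<^sup>p + \<parallel>y\<parallel>\<^sup>p) / 2\<close>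
  (\<open>deviation_bound\<close>). If \<open>\<epsilon>\<close> is a suitable fraction of the distance of two vectors in the unit
  ball of \<open>L\<^sup>p(S)\<close>, the integral of this inequality puts their midpoint well inside the ball
  (\<open>uniformly_convex_Lp\<close>).

  Conversely, a single exponent \<open>p\<close> suffices, and the modulus of \<open>L\<^sup>p(S)\<close> serves \<open>S\<close> unchanged. If
  \<open>x, y\<close> in the random unit ball violate the pointwise condition on an event \<open>F\<close> of positive
  probability, then \<open>P(F)\<^sup>-\<^sup>1\<^sup>/\<^sup>p I\<^sub>F x\<close> and \<open>P(F)\<^sup>-\<^sup>1\<^sup>/\<^sup>p I\<^sub>F y\<close> violate the uniform convexity of
  \<open>L\<^sup>p(S)\<close>, because their \<open>p\<close>-norms are averages over \<open>F\<close> (\<open>random_uniformly_convex_if_Lp\<close>).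
\<close>

section \<open>Convexity of powers on the half-line\<close>

text \<open>
  The gap between the two sides vanishes at \<open>b = 1\<close>, and it decreases on \<open>(b, 1)\<close> because there
  \<open>t\<close> lies below the midpoint \<open>(1 + t) / 2\<close>.
\<close>

lemma powr_midpoint_strict:
  fixes b p :: real
  assumes p: "1 < p" and b: "0 \<le> b" "b < 1"
  shows "((1 + b) / 2) powr p < (1 + b powr p) / 2"
proof -
  define h where "h = (\<lambda>t::real. (1 + t powr p) / 2 - ((1 + t) / 2) powr p)"
  have "h b > h 1"
  proof (rule DERIV_neg_imp_decreasing_open[OF b(2)])
    fix t :: real assume t: "b < t" "t < 1"
    then have t0: "0 < t" using b by simp
    have "(h has_real_derivative (p * t powr (p - 1)) / 2 - (p * ((1 + t) / 2) powr (p - 1)) / 2) (at t)"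
      unfolding h_def using t0
      by (auto intro!: derivative_eq_intros simp: field_simps)
    moreover have "t powr (p - 1) < ((1 + t) / 2) powr (p - 1)"
      using t0 t p by (intro powr_less_mono2) auto
    ultimately show "\<exists>y. (h has_real_derivative y) (at t) \<and> y < 0"
      using p by (intro exI[of _ "(p * t powr (p - 1)) / 2 - (p * ((1 + t) / 2) powr (p - 1)) / 2"]) auto
  next
    show "continuous_on {b..1} h"
      unfolding h_def using b p by (intro continuous_intros continuous_on_powr') auto
  qed
  then show ?thesis by (simp add: h_def)
qed

text \<open>
  By homogeneity the larger of \<open>a\<close> and \<open>b\<close> may be taken to be \<open>1\<close>, the other one \<open>t\<close>. The quotient
  \<open>g t\<close> of the greatest possible \<open>(c / 2) powr p\<close> by the mean of the powers is below \<open>1\<close> for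
  \<open>t < 1\<close> by strict convexity and at \<open>t = 1\<close> by the factor \<open>1 - \<delta>\<close>; compactness of \<open>[0, 1]\<close> makes the bound uniform.
\<close>

lemma power_mean_gap:
  fixes p \<delta> :: real
  assumes p: "1 < p" and \<delta>: "0 < \<delta>" "\<delta> < 1"
  obtains \<eta> where "0 < \<eta>" "\<eta> \<le> 1"
    "\<And>a b c. \<lbrakk>0 \<le> a; 0 \<le> b; 0 \<le> c; c \<le> a + b; c \<le> 2 * (1 - \<delta>) * max a b\<rbrakk>
       \<Longrightarrow> (c / 2) powr p \<le> (1 - \<eta>) * ((a powr p + b powr p) / 2)"
proof -
  define g where "g = (\<lambda>t::real. (min ((1 + t) / 2) (1 - \<delta>)) powr p / ((1 + t powr p) / 2))"
  have pos: "0 < 1 + t powr p" for t :: real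
    using powr_ge_zero[of t p] by linarith
  have "continuous_on {0..1} g"
    unfolding g_def using p \<delta> pos
    by (intro continuous_intros continuous_on_powr')
       (auto simp: min_def less_imp_neq[THEN not_sym])
  then obtain t0 where t0: "t0 \<in> {0..1}" and max: "\<And>t. t \<in> {0..1} \<Longrightarrow> g t \<le> g t0"
    using continuous_attains_sup[of "{0..1::real}" g] by auto
  have "(min ((1 + t0) / 2) (1 - \<delta>)) powr p < (1 + t0 powr p) / 2"
  proof (cases "t0 = 1")
    case True
    have "(1 - \<delta>) powr p < 1 powr p" using p \<delta> by (intro powr_less_mono2) auto
    then show ?thesis using True \<delta> by (simp add: min_def)
  next
    case False
    have "(min ((1 + t0) / 2) (1 - \<delta>)) powr p \<le> ((1 + t0) / 2) powr p"
      using p \<delta> t0 by (intro powr_mono2) (auto simp: min_def)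
    also have "\<dots> < (1 + t0 powr p) / 2"
      using False t0 p by (intro powr_midpoint_strict) auto
    finally show ?thesis .
  qed
  then have g1: "g t0 < 1" using pos[of t0] by (simp add: g_def field_simps)
  have g0: "0 \<le> g t0" using pos[of t0] by (simp add: g_def)
  have half: "(c / 2) powr p \<le> g t0 * ((a powr p + b powr p) / 2)"
    if "0 \<le> a" "0 \<le> b" "0 \<le> c" "c \<le> a + b" "c \<le> 2 * (1 - \<delta>) * a" "b \<le> a" for a b c
  proof (cases "a = 0")
    case True
    then have "b = 0" "c = 0" using that by auto
    then show ?thesis using True by simp
  next
    case False
    define t where "t = b / a"
    have t: "t \<in> {0..1}" and a: "0 < a" and b: "b = a * t"
      using False that by (auto simp: t_def)
    have "c / 2 \<le> a * min ((1 + t) / 2) (1 - \<delta>)"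
      using that a unfolding b by (auto simp: min_def field_simps)
    then have "(c / 2) powr p \<le> (a * min ((1 + t) / 2) (1 - \<delta>)) powr p"
      using that p by (intro powr_mono2) auto
    also have "\<dots> = a powr p * (g t * ((1 + t powr p) / 2))"
      using a t \<delta> pos[of t] by (simp add: powr_mult g_def field_simps)
    also have "\<dots> \<le> a powr p * (g t0 * ((1 + t powr p) / 2))"
      using max[OF t] pos[of t] by (intro mult_left_mono mult_right_mono) auto
    also have "\<dots> = g t0 * ((a powr p + b powr p) / 2)"
      using a t by (simp add: b powr_mult field_simps)
    finally show ?thesis .
  qed
  show thesis
  proof
    show "0 < 1 - g t0" "1 - g t0 \<le> 1" using g0 g1 by auto
    fix a b c :: real
    assume "0 \<le> a" "0 \<le> b" "0 \<le> c" "c \<le> a + b" "c \<le> 2 * (1 - \<delta>) * max a b"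
    then show "(c / 2) powr p \<le> (1 - (1 - g t0)) * ((a powr p + b powr p) / 2)"
      using half[of a b c] half[of b a c] by (cases "b \<le> a") (auto simp: max_def add.commute)
  qed
qed

lemma powr_inverse_le_iff:
  fixes s t p :: real
  assumes "0 \<le> s" "0 \<le> t" "0 < p"
  shows "s powr (1 / p) \<le> t \<longleftrightarrow> s \<le> t powr p"
proof -
  have "s powr (1 / p) \<le> t \<longleftrightarrow> (s powr (1 / p)) powr p \<le> t powr p"
    using assms by (meson powr_ge_zero powr_mono2 powr_less_mono2 not_less less_imp_le)
  then show ?thesis using assms by (simp add: powr_powr)
qed

lemma le_powr_inverse_iff:
  fixes s t p :: real
  assumes "0 \<le> s" "0 \<le> t" "0 < p"
  shows "t \<le> s powr (1 / p) \<longleftrightarrow> t powr p \<le> s"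
proof -
  have "t \<le> s powr (1 / p) \<longleftrightarrow> t powr p \<le> (s powr (1 / p)) powr p"
    using assms by (meson powr_ge_zero powr_mono2 powr_less_mono2 not_less less_imp_le)
  then show ?thesis using assms by (simp add: powr_powr)
qed

lemma power_mean_le:
  fixes a b p :: real
  assumes p: "1 < p" and "0 \<le> a" "0 \<le> b"
  shows "((a + b) / 2) powr p \<le> (a powr p + b powr p) / 2"
proof -
  have half: "((a + b) / 2) powr p \<le> (a powr p + b powr p) / 2" if "0 < a" "0 \<le> b" "b \<le> a" for a b :: real
  proof (cases "b = a")
    case False
    have "((1 + b / a) / 2) powr p < (1 + (b / a) powr p) / 2"
      using that False p by (intro powr_midpoint_strict) auto
    then have "a powr p * ((1 + b / a) / 2) powr p \<le> a powr p * ((1 + (b / a) powr p) / 2)"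
      by (intro mult_left_mono) auto
    moreover have "a powr p * ((1 + b / a) / 2) powr p = ((a + b) / 2) powr p"
      using that by (subst powr_mult[symmetric]) (auto simp: distrib_left)
    moreover have "a powr p * ((1 + (b / a) powr p) / 2) = (a powr p + b powr p) / 2"
      using that by (simp add: powr_divide field_simps)
    ultimately show ?thesis by simp
  qed simp
  show ?thesis
    using half[of a b] half[of b a] assms
    by (cases "b \<le> a"; cases "a = 0"; cases "b = 0") (auto simp: add.commute)
qed

text \<open>
  Here \<open>a, b, c, d\<close> stand for the norms of \<open>x\<close>, \<open>y\<close>, \<open>x + y\<close>, \<open>x - y\<close> at one point. If \<open>d\<close> is
  small relative to \<open>a\<close> and \<open>b\<close>, the summand with \<open>\<epsilon>\<close> absorbs it. If \<open>d\<close> is large, then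
  \<open>d powr p\<close> is at most \<open>2 powr p\<close> times the mean of the powers, and the gap \<open>\<eta>\<close> of
  \<open>power_mean_gap\<close>, multiplied by \<open>C = 2 powr p / \<eta>\<close>, pays for exactly that. One inequality
  without a case distinction can then be integrated at once.
\<close>

lemma deviation_bound:
  fixes p \<delta> \<epsilon> :: real
  assumes p: "1 < p" and \<delta>: "0 < \<delta>" "\<delta> < 1" and \<epsilon>: "0 < \<epsilon>"
  obtains C where "2 powr p \<le> C"
    "\<And>a b c d. \<lbrakk>0 \<le> a; 0 \<le> b; 0 \<le> c; 0 \<le> d; c \<le> a + b; d \<le> a + b;
        \<epsilon> * max a b \<le> d \<Longrightarrow> c \<le> 2 * (1 - \<delta>) * max a b\<rbrakk>
       \<Longrightarrow> C * (c / 2) powr p + d powr p \<le> (2 * \<epsilon> powr p + C) * ((a powr p + b powr p) / 2)"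
proof -
  obtain \<eta> where \<eta>: "0 < \<eta>" "\<eta> \<le> 1"
    and gap: "\<And>a b c. \<lbrakk>0 \<le> a; 0 \<le> b; 0 \<le> c; c \<le> a + b; c \<le> 2 * (1 - \<delta>) * max a b\<rbrakk>
       \<Longrightarrow> (c / 2) powr p \<le> (1 - \<eta>) * ((a powr p + b powr p) / 2)"
    using power_mean_gap[OF p \<delta>] by blast
  define C where "C = 2 powr p / \<eta>"
  have C: "0 < C" "C * \<eta> = 2 powr p" using \<eta> by (auto simp: C_def)
  show thesis
  proof
    show "2 powr p \<le> C" using \<eta> by (simp add: C_def field_simps)
    fix a b c d :: real
    assume nn: "0 \<le> a" "0 \<le> b" "0 \<le> c" "0 \<le> d" and le: "c \<le> a + b" "d \<le> a + b"
      and conv: "\<epsilon> * max a b \<le> d \<Longrightarrow> c \<le> 2 * (1 - \<delta>) * max a b"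
    define A where "A = (a powr p + b powr p) / 2"
    have A: "0 \<le> A" by (simp add: A_def)
    have mid: "((a + b) / 2) powr p \<le> A"
      unfolding A_def using p nn by (intro power_mean_le)
    show "C * (c / 2) powr p + d powr p \<le> (2 * \<epsilon> powr p + C) * ((a powr p + b powr p) / 2)"
      unfolding A_def[symmetric]
    proof (cases "\<epsilon> * max a b \<le> d")
      case True
      have "C * (c / 2) powr p \<le> C * ((1 - \<eta>) * A)"
        unfolding A_def using gap[OF nn(1-3) le(1) conv[OF True]] C by (intro mult_left_mono) auto
      also have "\<dots> = C * A - 2 powr p * A"
        using C(2) by (simp add: algebra_simps flip: mult.assoc)
      finally have 1: "C * (c / 2) powr p \<le> C * A - 2 powr p * A" .
      have "d powr p \<le> (2 * ((a + b) / 2)) powr p"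
        using nn le p by (intro powr_mono2) auto
      also have "\<dots> = 2 powr p * ((a + b) / 2) powr p" using nn by (subst powr_mult) auto
      also have "\<dots> \<le> 2 powr p * A" using mid by (intro mult_left_mono) auto
      finally have "C * (c / 2) powr p + d powr p \<le> C * A" using 1 by linarith
      also have "\<dots> \<le> (2 * \<epsilon> powr p + C) * A" using A by (simp add: algebra_simps)
      finally show "C * (c / 2) powr p + d powr p \<le> (2 * \<epsilon> powr p + C) * A" .
    next
      case False
      have "(c / 2) powr p \<le> ((a + b) / 2) powr p" using nn le p by (intro powr_mono2) auto
      then have 1: "C * (c / 2) powr p \<le> C * A" using mid C by (intro mult_left_mono) auto
      have "d powr p \<le> (\<epsilon> * max a b) powr p" using False nn p by (intro powr_mono2) auto
      also have "\<dots> = \<epsilon> powr p * (max a b) powr p" using \<epsilon> nn by (subst powr_mult) auto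
      also have "\<dots> \<le> \<epsilon> powr p * (2 * A)"
        by (intro mult_left_mono) (auto simp: A_def max_def)
      finally show "C * (c / 2) powr p + d powr p \<le> (2 * \<epsilon> powr p + C) * A"
        using 1 by (simp add: algebra_simps)
    qed
  qed
qed

section \<open>Representatives of random variables and events\<close>

lemma rep_mult_AE:
  fixes \<xi> \<eta> :: "('w \<Rightarrow> 'k::{real_normed_field, second_countable_topology}) set"
  assumes "\<xi> \<in> carrier (L0 M)" "\<eta> \<in> carrier (L0 M)"
  shows "AE w in M. rep (\<xi> \<otimes>\<^bsub>L0 M\<^esub> \<eta>) w = rep \<xi> w * rep \<eta> w"
proof -
  have "AE w in M. rep (L0_class M (\<lambda>w. rep \<xi> w * rep \<eta> w)) w = rep \<xi> w * rep \<eta> w"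
    by (intro rep_L0_class borel_measurable_times rep_L0(1) assms)
  then show ?thesis by (simp add: L0_def)
qed

lemma rep_add_AE:
  fixes \<xi> \<eta> :: "('w \<Rightarrow> 'k::{real_normed_field, second_countable_topology}) set"
  assumes "\<xi> \<in> carrier (L0 M)" "\<eta> \<in> carrier (L0 M)"
  shows "AE w in M. rep (\<xi> \<oplus>\<^bsub>L0 M\<^esub> \<eta>) w = rep \<xi> w + rep \<eta> w"
proof -
  have "AE w in M. rep (L0_class M (\<lambda>w. rep \<xi> w + rep \<eta> w)) w = rep \<xi> w + rep \<eta> w"
    by (intro rep_L0_class borel_measurable_add rep_L0(1) assms)
  then show ?thesis by (simp add: L0_def)
qed

lemma L0_class_eqD:
  assumes "L0_class M f = L0_class M g" "g \<in> borel_measurable M"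
  shows "AE w in M. f w = g w"
proof -
  have "g \<in> L0_class M g" using assms(2) by (auto simp: L0_class_def L0_rel_def)
  then have "g \<in> L0_class M f" using assms(1) by simp
  then show ?thesis by (auto simp: L0_class_def L0_rel_def)
qed

lemma rep_event_class:
  assumes "A \<in> sets M"
  shows "rep (event_class M A) \<in> sets M" "AE w in M. w \<in> rep (event_class M A) \<longleftrightarrow> w \<in> A"
proof -
  have "A \<in> event_class M A" using assms by (auto simp: event_class_def event_rel_def)
  then have "rep (event_class M A) \<in> event_class M A"
    unfolding rep_def by (rule someI[of "\<lambda>B. B \<in> event_class M A"])
  then have *: "(A, rep (event_class M A)) \<in> event_rel M"
    by (subst (asm) (2) event_class_def) simp
  then show "rep (event_class M A) \<in> sets M" by (simp add: event_rel_def)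
  have "A - rep (event_class M A) \<union> (rep (event_class M A) - A) \<in> null_sets M"
    using * by (simp add: event_rel_def)
  then show "AE w in M. w \<in> rep (event_class M A) \<longleftrightarrow> w \<in> A"
    by (rule AE_not_in[THEN eventually_mono]) auto
qed

lemma rep_events_mod: "D \<in> events_mod M \<Longrightarrow> rep D \<in> sets M"
  unfolding events_mod_def
  by (elim quotientE) (auto simp: rep_event_class(1)[unfolded event_class_def])

lemma event_le_iff_AE:
  assumes "rep D \<in> sets M" "rep E \<in> sets M"
  shows "event_le M D E \<longleftrightarrow> (AE w in M. w \<in> rep D \<longrightarrow> w \<in> rep E)"
proof -
  have "{w \<in> space M. \<not> (w \<in> rep D \<longrightarrow> w \<in> rep E)} = rep D - rep E"
    using assms(1) sets.sets_into_space by auto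
  then show ?thesis
    using AE_iff_null[of M "\<lambda>w. w \<in> rep D \<longrightarrow> w \<in> rep E"] assms
    by (simp add: event_le_def sets.Diff)
qed

lemma rep_event_ind:
  assumes "rep D \<in> sets M"
  shows "event_ind M D \<in> carrier (L0 M)" "AE w in M. rep (event_ind M D) w = indicator (rep D) w"
  using assms by (auto simp: event_ind_def intro!: L0_class_closed rep_L0_class)

lemma L0_const_closed: "L0_const M c \<in> carrier (L0 M)"
  and rep_L0_const: "AE w in M. rep (L0_const M c) w = c"
  by (auto simp: L0_const_def intro!: L0_class_closed rep_L0_class)

lemma L0_le_const_on_event_iff:
  assumes D: "rep D \<in> sets M" and \<xi>: "\<xi> \<in> carrier (L0 M)"
  shows "L0_le M (L0_const M k \<otimes>\<^bsub>L0 M\<^esub> event_ind M D) (event_ind M D \<otimes>\<^bsub>L0 M\<^esub> \<xi>)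
           \<longleftrightarrow> (AE w in M. w \<in> rep D \<longrightarrow> k \<le> rep \<xi> w)"
    and "L0_le M (event_ind M D \<otimes>\<^bsub>L0 M\<^esub> \<xi>) (L0_const M k \<otimes>\<^bsub>L0 M\<^esub> event_ind M D)
           \<longleftrightarrow> (AE w in M. w \<in> rep D \<longrightarrow> rep \<xi> w \<le> k)"
proof -
  have "AE w in M.
     rep (L0_const M k \<otimes>\<^bsub>L0 M\<^esub> event_ind M D) w = k * indicator (rep D) w \<and>
     rep (event_ind M D \<otimes>\<^bsub>L0 M\<^esub> \<xi>) w = indicator (rep D) w * rep \<xi> w"
    using rep_mult_AE[OF L0_const_closed[of M k] rep_event_ind(1)[OF D]]
      rep_mult_AE[OF rep_event_ind(1)[OF D] \<xi>] rep_L0_const[of M k] rep_event_ind(2)[OF D]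
    by eventually_elim simp
  note ae = this
  show "L0_le M (L0_const M k \<otimes>\<^bsub>L0 M\<^esub> event_ind M D) (event_ind M D \<otimes>\<^bsub>L0 M\<^esub> \<xi>)
           \<longleftrightarrow> (AE w in M. w \<in> rep D \<longrightarrow> k \<le> rep \<xi> w)"
    unfolding L0_le_def using ae
    by (intro eventually_cong) (auto simp: indicator_def)
  show "L0_le M (event_ind M D \<otimes>\<^bsub>L0 M\<^esub> \<xi>) (L0_const M k \<otimes>\<^bsub>L0 M\<^esub> event_ind M D)
           \<longleftrightarrow> (AE w in M. w \<in> rep D \<longrightarrow> rep \<xi> w \<le> k)"
    unfolding L0_le_def using ae
    by (intro eventually_cong) (auto simp: indicator_def)
qed

section \<open>The pointwise norm of a random normed module\<close>

context random_normed_module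
begin

abbreviation pnorm :: "'s \<Rightarrow> 'w \<Rightarrow> real" where
  "pnorm x \<equiv> rep (nrm S x)"

lemma nrm_L0: "x \<in> carrier S \<Longrightarrow> nrm S x \<in> carrier (L0 M)"
  using nrm_closed by (auto simp: L0_plus_def)

lemma pnorm_measurable [measurable]: "x \<in> carrier S \<Longrightarrow> pnorm x \<in> borel_measurable M"
  by (intro rep_L0(1) nrm_L0)

lemma pnorm_nonneg:
  assumes "x \<in> carrier S"
  shows "AE w in M. 0 \<le> pnorm x w"
proof -
  have z: "AE w in M. rep \<zero>\<^bsub>L0 M\<^esub> w = (0::real)"
    using rep_L0_class[of "\<lambda>_. 0::real" M] by (simp add: L0_def)
  have "AE w in M. rep \<zero>\<^bsub>L0 M\<^esub> w \<le> pnorm x w"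
    using nrm_closed[OF assms] by (auto simp: L0_plus_def L0_le_def)
  with z show ?thesis by eventually_elim simp
qed

lemma pnorm_add_le:
  assumes "x \<in> carrier S" "y \<in> carrier S"
  shows "AE w in M. pnorm (x \<oplus>\<^bsub>S\<^esub> y) w \<le> pnorm x w + pnorm y w"
  using nrm_triangle[OF assms, unfolded L0_le_def] rep_add_AE[OF nrm_L0 nrm_L0, OF assms]
  by eventually_elim simp

lemma pnorm_smult:
  assumes "\<xi> \<in> carrier (L0 M)" "x \<in> carrier S"
  shows "AE w in M. pnorm (\<xi> \<odot>\<^bsub>S\<^esub> x) w = norm (rep \<xi> w) * pnorm x w"
proof -
  have m: "(\<lambda>w. norm (rep \<xi> w)) \<in> borel_measurable M"
    using rep_L0(1)[OF assms(1)] by measurable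
  show ?thesis
    using rep_mult_AE[OF L0_class_closed[OF m] nrm_L0[OF assms(2)]] rep_L0_class[OF m]
    unfolding nrm_smult[OF assms] L0_abs_def by eventually_elim simp
qed

text \<open>The scalar \<open>\<ominus> \<one>\<close> squares to \<open>1\<close>, so it has modulus \<open>1\<close> almost surely.\<close>

lemma pnorm_minus:
  assumes "x \<in> carrier S"
  shows "AE w in M. pnorm (\<ominus>\<^bsub>S\<^esub> x) w = pnorm x w"
proof -
  define u :: "('w \<Rightarrow> 'k) set" where "u = \<ominus>\<^bsub>L0 M\<^esub> \<one>\<^bsub>L0 M\<^esub>"
  have u: "u \<in> carrier (L0 M)" by (simp add: u_def)
  have "u \<otimes>\<^bsub>L0 M\<^esub> u = \<one>\<^bsub>L0 M\<^esub>" by (simp add: u_def R.l_minus R.r_minus)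
  then have "L0_class M (\<lambda>w. rep u w * rep u w) = L0_class M (\<lambda>w. 1)" by (simp add: L0_def)
  then have "AE w in M. rep u w * rep u w = 1" by (rule L0_class_eqD) simp
  then have "AE w in M. norm (rep u w) = 1"
    by eventually_elim (metis norm_mult norm_one norm_ge_zero abs_square_eq_1 abs_of_nonneg power2_eq_square)
  moreover have "u \<odot>\<^bsub>S\<^esub> x = \<ominus>\<^bsub>S\<^esub> x"
    using assms by (simp add: u_def smult_l_minus)
  ultimately show ?thesis
    using pnorm_smult[OF u assms] by auto
qed

lemma pnorm_diff_le:
  assumes "x \<in> carrier S" "y \<in> carrier S"
  shows "AE w in M. pnorm (x \<ominus>\<^bsub>S\<^esub> y) w \<le> pnorm x w + pnorm y w"
  using pnorm_add_le[OF assms(1) a_inv_closed[OF assms(2)]] pnorm_minus[OF assms(2)]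
  by eventually_elim (simp add: a_minus_def)

text \<open>
  Real random variables act on \<open>S\<close> through the embedding of the reals into the scalar field, so that
  real and complex modules can be treated alike.
\<close>

definition scale :: "('w \<Rightarrow> real) \<Rightarrow> 's \<Rightarrow> 's" where
  "scale f x = L0_class M (\<lambda>w. of_real (f w)) \<odot>\<^bsub>S\<^esub> x"

context
  fixes f :: "'w \<Rightarrow> real"
  assumes f [measurable]: "f \<in> borel_measurable M"
begin

lemma of_real_borel: "(\<lambda>w. of_real (f w) :: 'k) \<in> borel_measurable M"
  by (rule measurable_compose[OF f]) (intro borel_measurable_continuous_onI continuous_intros)

lemma scale_closed [simp]: "x \<in> carrier S \<Longrightarrow> scale f x \<in> carrier S"
  unfolding scale_def by (intro smult_closed L0_class_closed of_real_borel)

lemma pnorm_scale: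
  assumes "x \<in> carrier S"
  shows "AE w in M. pnorm (scale f x) w = \<bar>f w\<bar> * pnorm x w"
  unfolding scale_def
  using pnorm_smult[OF L0_class_closed[OF of_real_borel] assms] rep_L0_class[OF of_real_borel]
  by eventually_elim simp

lemma scale_add:
  assumes "x \<in> carrier S" "y \<in> carrier S"
  shows "scale f x \<oplus>\<^bsub>S\<^esub> scale f y = scale f (x \<oplus>\<^bsub>S\<^esub> y)"
  unfolding scale_def using assms L0_class_closed[OF of_real_borel]
  by (simp add: smult_r_distr)

lemma scale_diff:
  assumes "x \<in> carrier S" "y \<in> carrier S"
  shows "scale f x \<ominus>\<^bsub>S\<^esub> scale f y = scale f (x \<ominus>\<^bsub>S\<^esub> y)"
  unfolding scale_def using assms L0_class_closed[OF of_real_borel]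
  by (simp add: smult_r_distr smult_r_minus a_minus_def)

end

end

section \<open>Random uniform convexity almost everywhere\<close>

lemma (in random_normed_module) rn_unit_ball_iff:
  "x \<in> rn_unit_ball M S \<longleftrightarrow> x \<in> carrier S \<and> (AE w in M. pnorm x w \<le> 1)"
proof -
  have "AE w in M. rep \<one>\<^bsub>L0 M\<^esub> w = (1::real)"
    using rep_L0_class[of "\<lambda>_. 1::real" M] by (simp add: L0_def)
  then have "L0_le M (nrm S x) \<one>\<^bsub>L0 M\<^esub> \<longleftrightarrow> (AE w in M. pnorm x w \<le> 1)"
    unfolding L0_le_def by (intro eventually_cong) auto
  then show ?thesis by (simp add: rn_unit_ball_def)
qed

lemma (in random_normed_module) rep_rn_A:
  assumes "x \<in> carrier S"
  shows "rep (rn_A M S x) \<in> sets M" "AE w in M. w \<in> rep (rn_A M S x) \<longleftrightarrow> 0 < pnorm x w"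
proof -
  have [measurable]: "pnorm x \<in> borel_measurable M" using assms by simp
  have s: "{w \<in> space M. 0 < pnorm x w} \<in> sets M" by measurable
  show "rep (rn_A M S x) \<in> sets M"
    unfolding rn_A_def event_pos_def by (rule rep_event_class[OF s])
  show "AE w in M. w \<in> rep (rn_A M S x) \<longleftrightarrow> 0 < pnorm x w"
    unfolding rn_A_def event_pos_def using rep_event_class(2)[OF s] AE_space
    by eventually_elim auto
qed

lemma rep_event_inter:
  assumes "rep D \<in> sets M" "rep E \<in> sets M"
  shows "rep (event_inter M D E) \<in> sets M"
    "AE w in M. w \<in> rep (event_inter M D E) \<longleftrightarrow> w \<in> rep D \<and> w \<in> rep E"
  using rep_event_class[of "rep D \<inter> rep E" M] assms by (auto simp: event_inter_def)

lemma (in random_normed_module) event_le_rn_B_iff: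
  assumes "x \<in> carrier S" "y \<in> carrier S" "rep D \<in> sets M"
  shows "event_le M D (rn_B M S x y) \<longleftrightarrow>
    (AE w in M. w \<in> rep D \<longrightarrow> 0 < pnorm x w \<and> 0 < pnorm y w \<and> 0 < pnorm (x \<ominus>\<^bsub>S\<^esub> y) w)"
proof -
  have d: "x \<ominus>\<^bsub>S\<^esub> y \<in> carrier S" using assms by simp
  note A = rep_rn_A[OF assms(1)] rep_rn_A[OF assms(2)] rep_rn_A[OF d]
  note I = rep_event_inter[OF A(1) A(3)]
  note B = rep_event_inter[OF I(1) A(5)]
  have "AE w in M. w \<in> rep (rn_B M S x y) \<longleftrightarrow>
      0 < pnorm x w \<and> 0 < pnorm y w \<and> 0 < pnorm (x \<ominus>\<^bsub>S\<^esub> y) w"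
    unfolding rn_B_def using A(2,4,6) I(2) B(2) by eventually_elim auto
  then have "(AE w in M. w \<in> rep D \<longrightarrow> w \<in> rep (rn_B M S x y)) \<longleftrightarrow>
    (AE w in M. w \<in> rep D \<longrightarrow> 0 < pnorm x w \<and> 0 < pnorm y w \<and> 0 < pnorm (x \<ominus>\<^bsub>S\<^esub> y) w)"
    by (intro eventually_cong) auto
  then show ?thesis
    using event_le_iff_AE[OF assms(3), of "rn_B M S x y"] B(1) by (simp add: rn_B_def)
qed

text \<open>
  The event \<open>D\<close> of the definition may be taken to be the largest admissible one, the event that
  \<open>x\<close> and \<open>y\<close> do not vanish and \<open>\<parallel>x - y\<parallel> \<ge> \<epsilon>\<close>. Where \<open>x\<close> or \<open>y\<close> vanishes, the sum has norm at
  most \<open>1\<close>, which is harmless once \<open>\<delta> \<le> 1/2\<close>.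
\<close>

lemma (in random_normed_module) random_uniformly_convex_iff_AE:
  "random_uniformly_convex M S \<longleftrightarrow>
     (\<forall>\<epsilon>::real. 0 < \<epsilon> \<and> \<epsilon> \<le> 2 \<longrightarrow> (\<exists>\<delta>::real. 0 < \<delta> \<and> \<delta> < 1 \<and>
        (\<forall>x\<in>carrier S. \<forall>y\<in>carrier S. (AE w in M. pnorm x w \<le> 1) \<longrightarrow> (AE w in M. pnorm y w \<le> 1) \<longrightarrow>
           (AE w in M. \<epsilon> \<le> pnorm (x \<ominus>\<^bsub>S\<^esub> y) w \<longrightarrow> pnorm (x \<oplus>\<^bsub>S\<^esub> y) w \<le> 2 * (1 - \<delta>)))))"
  (is "_ \<longleftrightarrow> (\<forall>\<epsilon>. _ \<longrightarrow> ?Q \<epsilon>)")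
  unfolding random_uniformly_convex_def
proof (intro iff_allI imp_cong refl iffI)
  fix \<epsilon> :: real assume \<epsilon>: "0 < \<epsilon> \<and> \<epsilon> \<le> 2"
  assume "\<exists>\<delta>::real. 0 < \<delta> \<and> \<delta> < 1 \<and>
         (\<forall>x\<in>rn_unit_ball M S. \<forall>y\<in>rn_unit_ball M S. \<forall>D\<in>events_mod M.
            event_le M D (rn_B M S x y) \<and> event_prob M D > 0 \<longrightarrow>
            L0_le M (L0_const M \<epsilon> \<otimes>\<^bsub>L0 M\<^esub> event_ind M D)
                    (event_ind M D \<otimes>\<^bsub>L0 M\<^esub> nrm S (x \<ominus>\<^bsub>S\<^esub> y)) \<longrightarrow>
            L0_le M (event_ind M D \<otimes>\<^bsub>L0 M\<^esub> nrm S (x \<oplus>\<^bsub>S\<^esub> y))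
                    (L0_const M (2 * (1 - \<delta>)) \<otimes>\<^bsub>L0 M\<^esub> event_ind M D))"
  then obtain \<delta> :: real where \<delta>: "0 < \<delta>" "\<delta> < 1" and
    conv: "\<And>x y D. \<lbrakk>x \<in> rn_unit_ball M S; y \<in> rn_unit_ball M S; D \<in> events_mod M;
            event_le M D (rn_B M S x y); event_prob M D > 0;
            L0_le M (L0_const M \<epsilon> \<otimes>\<^bsub>L0 M\<^esub> event_ind M D)
                    (event_ind M D \<otimes>\<^bsub>L0 M\<^esub> nrm S (x \<ominus>\<^bsub>S\<^esub> y))\<rbrakk> \<Longrightarrow>
            L0_le M (event_ind M D \<otimes>\<^bsub>L0 M\<^esub> nrm S (x \<oplus>\<^bsub>S\<^esub> y))
                    (L0_const M (2 * (1 - \<delta>)) \<otimes>\<^bsub>L0 M\<^esub> event_ind M D)"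
    by blast
  show "?Q \<epsilon>"
  proof (intro exI[of _ "min \<delta> (1/2)"] conjI ballI impI)
    fix x y assume x: "x \<in> carrier S" and y: "y \<in> carrier S"
      and x1: "AE w in M. pnorm x w \<le> 1" and y1: "AE w in M. pnorm y w \<le> 1"
    have s: "x \<oplus>\<^bsub>S\<^esub> y \<in> carrier S" and d: "x \<ominus>\<^bsub>S\<^esub> y \<in> carrier S" using x y by auto
    define A where "A = {w \<in> space M. 0 < pnorm x w \<and> 0 < pnorm y w \<and> \<epsilon> \<le> pnorm (x \<ominus>\<^bsub>S\<^esub> y) w}"
    have A: "A \<in> sets M" unfolding A_def using pnorm_measurable[OF x] pnorm_measurable[OF y] pnorm_measurable[OF d] by measurable
    define D where "D = event_class M A"
    have D: "rep D \<in> sets M" and DA: "AE w in M. w \<in> rep D \<longleftrightarrow> w \<in> A"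
      unfolding D_def using rep_event_class[OF A] by auto
    have on_D: "AE w in M. w \<in> rep D \<longrightarrow> pnorm (x \<oplus>\<^bsub>S\<^esub> y) w \<le> 2 * (1 - \<delta>)"
    proof (cases "event_prob M D > 0")
      case True
      have "D \<in> events_mod M"
        unfolding D_def events_mod_def event_class_def using A by (rule quotientI)
      moreover have "event_le M D (rn_B M S x y)"
        unfolding event_le_rn_B_iff[OF x y D] using DA by eventually_elim (use \<epsilon> in \<open>force simp: A_def\<close>)
      moreover have "L0_le M (L0_const M \<epsilon> \<otimes>\<^bsub>L0 M\<^esub> event_ind M D)
                    (event_ind M D \<otimes>\<^bsub>L0 M\<^esub> nrm S (x \<ominus>\<^bsub>S\<^esub> y))"
        unfolding L0_le_const_on_event_iff[OF D nrm_L0[OF d]]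
        using DA by eventually_elim (auto simp: A_def)
      ultimately have "L0_le M (event_ind M D \<otimes>\<^bsub>L0 M\<^esub> nrm S (x \<oplus>\<^bsub>S\<^esub> y))
                    (L0_const M (2 * (1 - \<delta>)) \<otimes>\<^bsub>L0 M\<^esub> event_ind M D)"
        using x y x1 y1 True by (intro conv) (auto simp: rn_unit_ball_iff)
      then show ?thesis unfolding L0_le_const_on_event_iff[OF D nrm_L0[OF s]] .
    next
      case False
      then have "rep D \<in> null_sets M"
        using D by (auto simp: event_prob_def null_sets_def emeasure_eq_measure zero_less_measure_iff)
      then show ?thesis by (rule AE_not_in[THEN eventually_mono]) auto
    qed
    show "AE w in M. \<epsilon> \<le> pnorm (x \<ominus>\<^bsub>S\<^esub> y) w \<longrightarrow> pnorm (x \<oplus>\<^bsub>S\<^esub> y) w \<le> 2 * (1 - min \<delta> (1/2))"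
      using on_D DA AE_space x1 y1 pnorm_nonneg[OF x] pnorm_nonneg[OF y] pnorm_add_le[OF x y]
    proof eventually_elim
      case (elim w)
      then show ?case
        by (cases "0 < pnorm x w \<and> 0 < pnorm y w") (auto simp: A_def min_def)
    qed
  qed (use \<delta> in auto)
next
  fix \<epsilon> :: real
  assume "?Q \<epsilon>"
  then obtain \<delta> where \<delta>: "0 < \<delta>" "\<delta> < 1" and
    conv: "\<And>x y. \<lbrakk>x \<in> carrier S; y \<in> carrier S; AE w in M. pnorm x w \<le> 1; AE w in M. pnorm y w \<le> 1\<rbrakk>
      \<Longrightarrow> AE w in M. \<epsilon> \<le> pnorm (x \<ominus>\<^bsub>S\<^esub> y) w \<longrightarrow> pnorm (x \<oplus>\<^bsub>S\<^esub> y) w \<le> 2 * (1 - \<delta>)"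
    by blast
  show "\<exists>\<delta>::real. 0 < \<delta> \<and> \<delta> < 1 \<and>
         (\<forall>x\<in>rn_unit_ball M S. \<forall>y\<in>rn_unit_ball M S. \<forall>D\<in>events_mod M.
            event_le M D (rn_B M S x y) \<and> event_prob M D > 0 \<longrightarrow>
            L0_le M (L0_const M \<epsilon> \<otimes>\<^bsub>L0 M\<^esub> event_ind M D)
                    (event_ind M D \<otimes>\<^bsub>L0 M\<^esub> nrm S (x \<ominus>\<^bsub>S\<^esub> y)) \<longrightarrow>
            L0_le M (event_ind M D \<otimes>\<^bsub>L0 M\<^esub> nrm S (x \<oplus>\<^bsub>S\<^esub> y))
                    (L0_const M (2 * (1 - \<delta>)) \<otimes>\<^bsub>L0 M\<^esub> event_ind M D))"
  proof (intro exI[of _ \<delta>] conjI ballI impI \<delta>)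
    fix x y D
    assume "x \<in> rn_unit_ball M S" "y \<in> rn_unit_ball M S" and "D \<in> events_mod M"
      and le: "L0_le M (L0_const M \<epsilon> \<otimes>\<^bsub>L0 M\<^esub> event_ind M D)
                    (event_ind M D \<otimes>\<^bsub>L0 M\<^esub> nrm S (x \<ominus>\<^bsub>S\<^esub> y))"
    then have x: "x \<in> carrier S" "AE w in M. pnorm x w \<le> 1" and y: "y \<in> carrier S" "AE w in M. pnorm y w \<le> 1"
      and D: "rep D \<in> sets M"
      by (auto simp: rn_unit_ball_iff rep_events_mod)
    have s: "x \<oplus>\<^bsub>S\<^esub> y \<in> carrier S" and d: "x \<ominus>\<^bsub>S\<^esub> y \<in> carrier S" using x y by auto
    show "L0_le M (event_ind M D \<otimes>\<^bsub>L0 M\<^esub> nrm S (x \<oplus>\<^bsub>S\<^esub> y))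
                    (L0_const M (2 * (1 - \<delta>)) \<otimes>\<^bsub>L0 M\<^esub> event_ind M D)"
      using le conv[OF x(1) y(1) x(2) y(2)]
      unfolding L0_le_const_on_event_iff[OF D nrm_L0[OF s]] L0_le_const_on_event_iff[OF D nrm_L0[OF d]]
      by eventually_elim auto
  qed
qed

text \<open>
  Dividing \<open>x\<close> and \<open>y\<close> by the random variable \<open>max (pnorm x) (pnorm y)\<close>, read as \<open>0\<close> where that
  vanishes, reduces arbitrary vectors to the unit ball.
\<close>

lemma (in random_normed_module) random_uniformly_convex_max:
  assumes "random_uniformly_convex M S" and \<epsilon>: "0 < \<epsilon>" "\<epsilon> \<le> 2"
  obtains \<delta> where "0 < \<delta>" "\<delta> < 1"
    "\<And>x y. \<lbrakk>x \<in> carrier S; y \<in> carrier S\<rbrakk> \<Longrightarrow> AE w in M.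
       \<epsilon> * max (pnorm x w) (pnorm y w) \<le> pnorm (x \<ominus>\<^bsub>S\<^esub> y) w \<longrightarrow>
       pnorm (x \<oplus>\<^bsub>S\<^esub> y) w \<le> 2 * (1 - \<delta>) * max (pnorm x w) (pnorm y w)"
proof -
  obtain \<delta> where \<delta>: "0 < \<delta>" "\<delta> < 1" and
    conv: "\<And>x y. \<lbrakk>x \<in> carrier S; y \<in> carrier S; AE w in M. pnorm x w \<le> 1; AE w in M. pnorm y w \<le> 1\<rbrakk>
      \<Longrightarrow> AE w in M. \<epsilon> \<le> pnorm (x \<ominus>\<^bsub>S\<^esub> y) w \<longrightarrow> pnorm (x \<oplus>\<^bsub>S\<^esub> y) w \<le> 2 * (1 - \<delta>)"
    using assms(1)[unfolded random_uniformly_convex_iff_AE, THEN spec, of \<epsilon>] \<epsilon>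
    by (elim impE exE conjE) auto
  show thesis
  proof (rule that[OF \<delta>])
    fix x y assume x: "x \<in> carrier S" and y: "y \<in> carrier S"
    have s: "x \<oplus>\<^bsub>S\<^esub> y \<in> carrier S" and d: "x \<ominus>\<^bsub>S\<^esub> y \<in> carrier S" using x y by auto
    define f where "f = (\<lambda>w. inverse (max (pnorm x w) (pnorm y w)))"
    have f: "f \<in> borel_measurable M"
      unfolding f_def using pnorm_measurable[OF x] pnorm_measurable[OF y] by measurable
    have le_1: "\<bar>inverse (max a b)\<bar> * a \<le> 1" "\<bar>inverse (max a b)\<bar> * b \<le> 1" if "0 \<le> a" "0 \<le> b" for a b :: real
      using that by (auto simp: max_def divide_le_eq_1 divide_inverse[symmetric] mult.commute)
    have f_le_1: "\<bar>f w\<bar> * pnorm x w \<le> 1" "\<bar>f w\<bar> * pnorm y w \<le> 1"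
      if "0 \<le> pnorm x w" "0 \<le> pnorm y w" for w
      unfolding f_def by (rule le_1[OF that])+
    have bound_x: "AE w in M. pnorm (scale f x) w \<le> 1"
      using pnorm_scale[OF f x] pnorm_nonneg[OF x] pnorm_nonneg[OF y]
      by eventually_elim (simp add: f_le_1)
    have bound_y: "AE w in M. pnorm (scale f y) w \<le> 1"
      using pnorm_scale[OF f y] pnorm_nonneg[OF x] pnorm_nonneg[OF y]
      by eventually_elim (simp add: f_le_1)
    show "AE w in M.
       \<epsilon> * max (pnorm x w) (pnorm y w) \<le> pnorm (x \<ominus>\<^bsub>S\<^esub> y) w \<longrightarrow>
       pnorm (x \<oplus>\<^bsub>S\<^esub> y) w \<le> 2 * (1 - \<delta>) * max (pnorm x w) (pnorm y w)"
      using conv[OF scale_closed[OF f x] scale_closed[OF f y] bound_x bound_y, unfolded scale_add[OF f x y] scale_diff[OF f x y]]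
        pnorm_scale[OF f s] pnorm_scale[OF f d] pnorm_nonneg[OF x] pnorm_nonneg[OF y] pnorm_add_le[OF x y]
    proof eventually_elim
      case (elim w)
      define r where "r = max (pnorm x w) (pnorm y w)"
      show ?case unfolding r_def[symmetric]
      proof (cases "r = 0")
        case True
        then show "\<epsilon> * r \<le> pnorm (x \<ominus>\<^bsub>S\<^esub> y) w \<longrightarrow> pnorm (x \<oplus>\<^bsub>S\<^esub> y) w \<le> 2 * (1 - \<delta>) * r"
          using elim by (auto simp: r_def max_def split: if_splits)
      next
        case False
        then have r: "0 < r" using elim by (auto simp: r_def max_def)
        have "f w = inverse r" by (simp add: f_def r_def)
        then have "\<epsilon> \<le> pnorm (x \<ominus>\<^bsub>S\<^esub> y) w / r \<longrightarrow> pnorm (x \<oplus>\<^bsub>S\<^esub> y) w / r \<le> 2 * (1 - \<delta>)"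
          using elim r by (simp add: divide_inverse mult.commute)
        then show "\<epsilon> * r \<le> pnorm (x \<ominus>\<^bsub>S\<^esub> y) w \<longrightarrow> pnorm (x \<oplus>\<^bsub>S\<^esub> y) w \<le> 2 * (1 - \<delta>) * r"
          using r by (simp add: pos_le_divide_eq pos_divide_le_eq)
      qed
    qed
  qed
qed

section \<open>The norm of \<open>L\<^sup>p(S)\<close> as a real integral\<close>

context random_normed_module
begin

text \<open>
  A Bochner integral is \<open>0\<close> for functions that are not integrable, just as \<open>enn2real\<close> sends \<open>\<infinity>\<close> to
  \<open>0\<close>. Hence the norm of \<open>Lp_space\<close> is \<open>pmoment p x powr (1 / p)\<close> on all of \<open>S\<close>.
\<close>

definition pmoment :: "real \<Rightarrow> 's \<Rightarrow> real" where
  "pmoment p x = (\<integral>w. pnorm x w powr p \<partial>M)"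

lemma pmoment_nonneg: "0 \<le> pmoment p x"
  by (simp add: pmoment_def)

lemma Lp_int_finite_iff:
  assumes "x \<in> carrier S"
  shows "Lp_int M S p x < \<infinity> \<longleftrightarrow> integrable M (\<lambda>w. pnorm x w powr p)"
  using pnorm_measurable[OF assms] by (simp add: Lp_int_def integrable_iff_bounded)

lemma in_Lp_iff:
  "x \<in> carrier (Lp_space M S p) \<longleftrightarrow> x \<in> carrier S \<and> integrable M (\<lambda>w. pnorm x w powr p)"
  using Lp_int_finite_iff by (auto simp: Lp_space_def)

lemma Lp_nrm:
  assumes "x \<in> carrier S"
  shows "nrm (Lp_space M S p) x = pmoment p x powr (1 / p)"
proof -
  have "pmoment p x = enn2real (Lp_int M S p x)"
    unfolding pmoment_def Lp_int_def
    using pnorm_measurable[OF assms] by (intro integral_eq_nn_integral) auto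
  then show ?thesis by (simp add: Lp_space_def)
qed

lemma Lp_nrm_le_iff:
  assumes "x \<in> carrier S" "0 < p" "0 \<le> t"
  shows "nrm (Lp_space M S p) x \<le> t \<longleftrightarrow> pmoment p x \<le> t powr p"
  using assms by (simp add: Lp_nrm powr_inverse_le_iff pmoment_nonneg)

lemma le_Lp_nrm_iff:
  assumes "x \<in> carrier S" "0 < p" "0 \<le> t"
  shows "t \<le> nrm (Lp_space M S p) x \<longleftrightarrow> t powr p \<le> pmoment p x"
  using assms by (simp add: Lp_nrm le_powr_inverse_iff pmoment_nonneg)

lemma Lp_add: "x \<oplus>\<^bsub>Lp_space M S p\<^esub> y = x \<oplus>\<^bsub>S\<^esub> y"
  by (simp add: Lp_space_def)

lemma Lp_minus_closed:
  assumes "x \<in> carrier (Lp_space M S p)"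
  shows "\<ominus>\<^bsub>S\<^esub> x \<in> carrier (Lp_space M S p)"
proof -
  have x: "x \<in> carrier S" and i: "integrable M (\<lambda>w. pnorm x w powr p)"
    using assms by (auto simp: in_Lp_iff)
  have "integrable M (\<lambda>w. pnorm (\<ominus>\<^bsub>S\<^esub> x) w powr p)"
    using i
  proof (rule integrable_cong_AE_imp)
    show "(\<lambda>w. pnorm (\<ominus>\<^bsub>S\<^esub> x) w powr p) \<in> borel_measurable M"
      using pnorm_measurable[OF a_inv_closed[OF x]] by measurable
    show "AE w in M. pnorm x w powr p = pnorm (\<ominus>\<^bsub>S\<^esub> x) w powr p"
      using pnorm_minus[OF x] by eventually_elim simp
  qed
  then show ?thesis using x by (simp add: in_Lp_iff)
qed

text \<open>
  The additive inverse of \<open>L\<^sup>p(S)\<close> is the one of \<open>S\<close>, because a description by uniqueness in \<open>S\<close>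
  stays unique in a subset that contains the inverse.
\<close>

lemma Lp_diff:
  assumes "x \<in> carrier (Lp_space M S p)" "y \<in> carrier (Lp_space M S p)"
  shows "x \<ominus>\<^bsub>Lp_space M S p\<^esub> y = x \<ominus>\<^bsub>S\<^esub> y"
proof -
  have y: "y \<in> carrier S" using assms by (simp add: in_Lp_iff)
  have zero: "\<zero>\<^bsub>Lp_space M S p\<^esub> = \<zero>\<^bsub>S\<^esub>" by (simp add: Lp_space_def)
  have "\<ominus>\<^bsub>Lp_space M S p\<^esub> y = \<ominus>\<^bsub>S\<^esub> y"
    unfolding a_inv_def[of "Lp_space M S p"] m_inv_def
  proof (rule the_equality)
    show "\<ominus>\<^bsub>S\<^esub> y \<in> carrier (add_monoid (Lp_space M S p)) \<and>
      y \<otimes>\<^bsub>add_monoid (Lp_space M S p)\<^esub> \<ominus>\<^bsub>S\<^esub> y = \<one>\<^bsub>add_monoid (Lp_space M S p)\<^esub> \<and>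
      \<ominus>\<^bsub>S\<^esub> y \<otimes>\<^bsub>add_monoid (Lp_space M S p)\<^esub> y = \<one>\<^bsub>add_monoid (Lp_space M S p)\<^esub>"
      using Lp_minus_closed[OF assms(2)] y by (simp add: Lp_add zero r_neg l_neg)
    fix z assume "z \<in> carrier (add_monoid (Lp_space M S p)) \<and>
      y \<otimes>\<^bsub>add_monoid (Lp_space M S p)\<^esub> z = \<one>\<^bsub>add_monoid (Lp_space M S p)\<^esub> \<and>
      z \<otimes>\<^bsub>add_monoid (Lp_space M S p)\<^esub> y = \<one>\<^bsub>add_monoid (Lp_space M S p)\<^esub>"
    then show "z = \<ominus>\<^bsub>S\<^esub> y"
      using y by (auto simp: Lp_add zero in_Lp_iff intro: minus_equality[symmetric])
  qed
  then show ?thesis by (simp add: a_minus_def Lp_add)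
qed

lemma integrable_pnorm_powr_bound:
  assumes "x \<in> carrier S" "integrable M g" "AE w in M. pnorm x w powr p \<le> g w"
  shows "integrable M (\<lambda>w. pnorm x w powr p)"
  using assms(2)
proof (rule Bochner_Integration.integrable_bound)
  show "(\<lambda>w. pnorm x w powr p) \<in> borel_measurable M"
    using pnorm_measurable[OF assms(1)] by measurable
  show "AE w in M. norm (pnorm x w powr p) \<le> norm (g w)"
    using assms(3) by eventually_elim (smt (verit) real_norm_def powr_ge_zero)
qed

end

section \<open>Random uniform convexity and uniform convexity of \<open>L\<^sup>p(S)\<close>\<close>

text \<open>
  Integrating \<open>deviation_bound\<close> over vectors of norm at most \<open>1\<close> leaves
  \<open>(\<parallel>x + y\<parallel>\<^sub>p / 2)\<^sup>p \<le> 1 - \<epsilon>\<^sup>p / (2 C)\<close>, whose right-hand side is the constant \<open>q\<close> below.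
\<close>

lemma (in random_normed_module) uniformly_convex_Lp:
  assumes ruc: "random_uniformly_convex M S" and p: "1 < p"
  shows "uniformly_convex (Lp_space M S p)"
  unfolding uniformly_convex_def
proof (intro allI impI)
  fix \<epsilon> :: real assume \<epsilon>: "0 < \<epsilon> \<and> \<epsilon> \<le> 2"
  \<comment> \<open>Chosen such that \<open>2 * \<epsilon>' powr p = \<epsilon> powr p / 2\<close>: the part of the difference that lies below
    the threshold of the pointwise modulus carries at most half of the required \<open>\<epsilon> powr p\<close>.\<close>
  define \<epsilon>' where "\<epsilon>' = \<epsilon> * (1 / 4) powr (1 / p)"
  have \<epsilon>'p: "2 * \<epsilon>' powr p = \<epsilon> powr p / 2"
    using \<epsilon> p by (simp add: \<epsilon>'_def powr_mult powr_powr)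
  have "(1 / 4) powr (1 / p) \<le> (1::real)" using p by (intro powr_le1) auto
  then have "\<epsilon>' \<le> 2 * 1" unfolding \<epsilon>'_def using \<epsilon> by (intro mult_mono) auto
  then have \<epsilon>': "0 < \<epsilon>'" "\<epsilon>' \<le> 2" using \<epsilon> by (auto simp: \<epsilon>'_def)
  obtain \<delta> where \<delta>: "0 < \<delta>" "\<delta> < 1" and
    conv: "\<And>x y. \<lbrakk>x \<in> carrier S; y \<in> carrier S\<rbrakk> \<Longrightarrow> AE w in M.
       \<epsilon>' * max (pnorm x w) (pnorm y w) \<le> pnorm (x \<ominus>\<^bsub>S\<^esub> y) w \<longrightarrow>
       pnorm (x \<oplus>\<^bsub>S\<^esub> y) w \<le> 2 * (1 - \<delta>) * max (pnorm x w) (pnorm y w)"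
    using random_uniformly_convex_max[OF ruc \<epsilon>'] by blast
  obtain C where C: "2 powr p \<le> C" and
    dev: "\<And>a b c d. \<lbrakk>0 \<le> a; 0 \<le> b; 0 \<le> c; 0 \<le> d; c \<le> a + b; d \<le> a + b;
        \<epsilon>' * max a b \<le> d \<Longrightarrow> c \<le> 2 * (1 - \<delta>) * max a b\<rbrakk>
       \<Longrightarrow> C * (c / 2) powr p + d powr p \<le> (2 * \<epsilon>' powr p + C) * ((a powr p + b powr p) / 2)"
    using deviation_bound[OF p \<delta> \<epsilon>'(1)] by blast
  have C0: "0 < C" using C by (smt (verit) powr_gt_zero)
  define q where "q = 1 - \<epsilon> powr p / (2 * C)"
  have "\<epsilon> powr p \<le> 2 powr p" using \<epsilon> p by (intro powr_mono2) auto
  then have q: "0 < q" "q < 1" using C C0 \<epsilon> by (auto simp: q_def field_simps)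
  show "\<exists>\<delta>::real. 0 < \<delta> \<and> \<delta> < 1 \<and>
         (\<forall>x\<in>carrier (Lp_space M S p). \<forall>y\<in>carrier (Lp_space M S p).
            nrm (Lp_space M S p) x \<le> 1 \<and> nrm (Lp_space M S p) y \<le> 1 \<and>
            nrm (Lp_space M S p) (x \<ominus>\<^bsub>Lp_space M S p\<^esub> y) \<ge> \<epsilon> \<longrightarrow>
            nrm (Lp_space M S p) (x \<oplus>\<^bsub>Lp_space M S p\<^esub> y) \<le> 2 * (1 - \<delta>))"
  proof (intro exI[of _ "1 - q powr (1 / p)"] conjI ballI impI)
    have "q powr (1 / p) < 1 powr (1 / p)" using q p by (intro powr_less_mono2) auto
    then show "0 < 1 - q powr (1 / p)" by simp
    show "1 - q powr (1 / p) < 1" using q by simp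
    fix x y
    assume xL: "x \<in> carrier (Lp_space M S p)" and yL: "y \<in> carrier (Lp_space M S p)"
      and xy: "nrm (Lp_space M S p) x \<le> 1 \<and> nrm (Lp_space M S p) y \<le> 1 \<and>
            nrm (Lp_space M S p) (x \<ominus>\<^bsub>Lp_space M S p\<^esub> y) \<ge> \<epsilon>"
    have x: "x \<in> carrier S" and ix: "integrable M (\<lambda>w. pnorm x w powr p)"
      and y: "y \<in> carrier S" and iy: "integrable M (\<lambda>w. pnorm y w powr p)"
      using xL yL by (auto simp: in_Lp_iff)
    define s where "s = x \<oplus>\<^bsub>S\<^esub> y"
    define d where "d = x \<ominus>\<^bsub>S\<^esub> y"
    have s: "s \<in> carrier S" and d: "d \<in> carrier S" using x y by (auto simp: s_def d_def)
    have mx: "pmoment p x \<le> 1" and my: "pmoment p y \<le> 1" and md: "\<epsilon> powr p \<le> pmoment p d"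
      using xy Lp_nrm_le_iff[OF x, of p 1] Lp_nrm_le_iff[OF y, of p 1] le_Lp_nrm_iff[OF d, of p \<epsilon>] p \<epsilon>
      by (auto simp: Lp_diff[OF xL yL] d_def)
    define g where "g = (\<lambda>w. (\<epsilon> powr p / 2 + C) * ((pnorm x w powr p + pnorm y w powr p) / 2))"
    have ig: "integrable M g" unfolding g_def using ix iy by auto
    have le: "AE w in M. C / 2 powr p * pnorm s w powr p + pnorm d w powr p \<le> g w"
      using conv[OF x y] pnorm_nonneg[OF x] pnorm_nonneg[OF y] pnorm_nonneg[OF s] pnorm_nonneg[OF d]
        pnorm_add_le[OF x y] pnorm_diff_le[OF x y]
    proof eventually_elim
      case (elim w)
      have "C * (pnorm s w / 2) powr p + pnorm d w powr p \<le> g w"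
        unfolding g_def \<epsilon>'p[symmetric] using elim by (intro dev) (auto simp: s_def d_def)
      then show ?case using elim by (simp add: powr_divide)
    qed
    have ids: "integrable M (\<lambda>w. pnorm d w powr p)"
    proof (rule integrable_pnorm_powr_bound[OF d ig])
      show "AE w in M. pnorm d w powr p \<le> g w"
        using le
      proof eventually_elim
        case (elim w)
        have "0 \<le> C / 2 powr p * pnorm s w powr p" using C0 by simp
        then show ?case using elim by linarith
      qed
    qed
    have iss: "integrable M (\<lambda>w. pnorm s w powr p)"
    proof (rule integrable_pnorm_powr_bound[OF s])
      show "integrable M (\<lambda>w. g w / (C / 2 powr p))" using ig by simp
      show "AE w in M. pnorm s w powr p \<le> g w / (C / 2 powr p)"
        using le
      proof eventually_elim
        case (elim w)
        have "0 \<le> pnorm d w powr p" by simp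
        then have "C / 2 powr p * pnorm s w powr p \<le> g w" using elim by linarith
        then show ?case using C0 by (simp add: field_simps)
      qed
    qed
    have "C / 2 powr p * pmoment p s + pmoment p d = (\<integral>w. C / 2 powr p * pnorm s w powr p + pnorm d w powr p \<partial>M)"
      using ids iss by (simp add: pmoment_def)
    also have "\<dots> \<le> (\<integral>w. g w \<partial>M)" using ids iss ig le by (intro integral_mono_AE) auto
    also have "\<dots> = (\<epsilon> powr p / 2 + C) * ((pmoment p x + pmoment p y) / 2)"
      using ix iy by (simp add: g_def pmoment_def)
    also have "\<dots> \<le> (\<epsilon> powr p / 2 + C) * 1"
      using mx my C0 by (intro mult_left_mono) auto
    finally have "C / 2 powr p * pmoment p s \<le> C - \<epsilon> powr p / 2" using md by simp
    then have "pmoment p s \<le> 2 powr p * q"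
      using C0 by (simp add: q_def field_simps)
    also have "2 powr p * q = (2 * q powr (1 / p)) powr p"
      using q p by (simp add: powr_mult powr_powr)
    finally show "nrm (Lp_space M S p) (x \<oplus>\<^bsub>Lp_space M S p\<^esub> y) \<le> 2 * (1 - (1 - q powr (1 / p)))"
      using Lp_nrm_le_iff[OF s, of p "2 * q powr (1 / p)"] p by (simp add: Lp_add s_def)
  qed
qed

lemma (in random_normed_module) pnorm_localized_powr:
  assumes z: "z \<in> carrier S" and F: "F \<in> sets M" and PF: "0 < prob F" and p: "1 < p"
  defines "f \<equiv> \<lambda>w. prob F powr (- 1 / p) * indicator F w"
  shows "f \<in> borel_measurable M"
    and "AE w in M. pnorm (scale f z) w powr p = indicator F w * pnorm z w powr p / prob F"
proof -
  show f: "f \<in> borel_measurable M" unfolding f_def using F by measurable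
  show "AE w in M. pnorm (scale f z) w powr p = indicator F w * pnorm z w powr p / prob F"
    using pnorm_scale[OF f z] pnorm_nonneg[OF z]
  proof eventually_elim
    case (elim w)
    then show ?case
      using PF p by (auto simp: f_def indicator_def powr_mult powr_divide powr_powr powr_minus_divide)
  qed
qed

text \<open>
  Let \<open>F\<close> be the event where \<open>x\<close> and \<open>y\<close> violate the pointwise condition. Restricted to \<open>F\<close> and
  normalised, a vector has as \<open>p\<close>-th moment the mean over \<open>F\<close> of \<open>\<parallel>\<cdot>\<parallel>\<^sup>p\<close>, so bounds that hold on
  \<open>F\<close> turn into bounds for the norm of \<open>L\<^sup>p(S)\<close>; a strict bound on \<open>F\<close> remains strict if \<open>F\<close> has
  positive probability.
\<close>

lemma (in random_normed_module) random_uniformly_convex_if_Lp: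
  assumes p: "1 < p" and uc: "uniformly_convex (Lp_space M S p)"
  shows "random_uniformly_convex M S"
  unfolding random_uniformly_convex_iff_AE
proof (intro allI impI)
  fix \<epsilon> :: real assume \<epsilon>: "0 < \<epsilon> \<and> \<epsilon> \<le> 2"
  let ?L = "Lp_space M S p"
  obtain \<delta> where \<delta>: "0 < \<delta>" "\<delta> < 1" and
    conv: "\<And>x y. \<lbrakk>x \<in> carrier ?L; y \<in> carrier ?L; nrm ?L x \<le> 1; nrm ?L y \<le> 1; \<epsilon> \<le> nrm ?L (x \<ominus>\<^bsub>?L\<^esub> y)\<rbrakk>
      \<Longrightarrow> nrm ?L (x \<oplus>\<^bsub>?L\<^esub> y) \<le> 2 * (1 - \<delta>)"
    using uc[unfolded uniformly_convex_def, THEN spec, of \<epsilon>] \<epsilon>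
    by (elim impE exE conjE) auto
  show "\<exists>\<delta>::real. 0 < \<delta> \<and> \<delta> < 1 \<and>
        (\<forall>x\<in>carrier S. \<forall>y\<in>carrier S. (AE w in M. pnorm x w \<le> 1) \<longrightarrow> (AE w in M. pnorm y w \<le> 1) \<longrightarrow>
           (AE w in M. \<epsilon> \<le> pnorm (x \<ominus>\<^bsub>S\<^esub> y) w \<longrightarrow> pnorm (x \<oplus>\<^bsub>S\<^esub> y) w \<le> 2 * (1 - \<delta>)))"
  proof (intro exI[of _ \<delta>] conjI ballI impI \<delta>)
    fix x y assume x: "x \<in> carrier S" and y: "y \<in> carrier S"
      and x1: "AE w in M. pnorm x w \<le> 1" and y1: "AE w in M. pnorm y w \<le> 1"
    define s where "s = x \<oplus>\<^bsub>S\<^esub> y"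
    define d where "d = x \<ominus>\<^bsub>S\<^esub> y"
    have s: "s \<in> carrier S" and d: "d \<in> carrier S" using x y by (auto simp: s_def d_def)
    have [measurable]: "pnorm s \<in> borel_measurable M" "pnorm d \<in> borel_measurable M"
      using s d by auto
    define F where "F = {w \<in> space M. \<epsilon> \<le> pnorm d w \<and> 2 * (1 - \<delta>) < pnorm s w}"
    have F: "F \<in> sets M" unfolding F_def by measurable
    have "\<not> 0 < prob F"
    proof
      assume PF: "0 < prob F"
      define f where "f = (\<lambda>w. prob F powr (- 1 / p) * indicator F w)"
      note loc = pnorm_localized_powr[OF _ F PF p, folded f_def]
      have f: "f \<in> borel_measurable M" using loc(1)[OF x] .
      have iF: "integrable M (\<lambda>w. indicator F w * k / prob F)" for k :: real
        using F by (intro integrable_divide integrable_mult_left integrable_real_indicator) (auto simp: emeasure_eq_measure)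
      have intF: "(\<integral>w. indicator F w * k / prob F \<partial>M) = k" for k :: real
        using F PF by simp
      have below: "integrable M (\<lambda>w. pnorm (scale f z) w powr p) \<and> pmoment p (scale f z) \<le> k powr p"
        if z: "z \<in> carrier S" and k: "AE w in M. w \<in> F \<longrightarrow> pnorm z w \<le> k" for z k
      proof
        have le: "AE w in M. pnorm (scale f z) w powr p \<le> indicator F w * k powr p / prob F"
          using loc(2)[OF z] k pnorm_nonneg[OF z]
        proof eventually_elim
          case (elim w)
          then show ?case using PF p
            by (auto simp: indicator_def intro!: divide_right_mono powr_mono2)
        qed
        show i: "integrable M (\<lambda>w. pnorm (scale f z) w powr p)"
          using integrable_pnorm_powr_bound[OF scale_closed[OF f z] iF le] .
        show "pmoment p (scale f z) \<le> k powr p"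
          using integral_mono_AE[OF i iF le] unfolding intF pmoment_def .
      qed
      have above: "k powr p \<le> pmoment p (scale f z)"
        if z: "z \<in> carrier S" and k: "0 \<le> k" "AE w in M. w \<in> F \<longrightarrow> k \<le> pnorm z w"
          and i: "integrable M (\<lambda>w. pnorm (scale f z) w powr p)" for z k
      proof -
        have "AE w in M. indicator F w * k powr p / prob F \<le> pnorm (scale f z) w powr p"
          using loc(2)[OF z] k(2)
        proof eventually_elim
          case (elim w)
          then show ?case using PF p k(1)
            by (auto simp: indicator_def intro!: divide_right_mono powr_mono2)
        qed
        from integral_mono_AE[OF iF i this] show ?thesis unfolding intF pmoment_def .
      qed
      have s2: "AE w in M. w \<in> F \<longrightarrow> pnorm s w \<le> 2" and d2: "AE w in M. w \<in> F \<longrightarrow> pnorm d w \<le> 2"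
        unfolding s_def d_def
        using pnorm_add_le[OF x y] pnorm_diff_le[OF x y] x1 y1 by (eventually_elim, auto)+
      have i_s: "integrable M (\<lambda>w. pnorm (scale f s) w powr p)" using below[OF s s2] by simp
      have i_d: "integrable M (\<lambda>w. pnorm (scale f d) w powr p)" using below[OF d d2] by simp
      have xF: "AE w in M. w \<in> F \<longrightarrow> pnorm x w \<le> 1" using x1 by eventually_elim simp
      have yF: "AE w in M. w \<in> F \<longrightarrow> pnorm y w \<le> 1" using y1 by eventually_elim simp
      have xL: "scale f x \<in> carrier ?L" "nrm ?L (scale f x) \<le> 1"
        using below[OF x xF] x f p by (auto simp: in_Lp_iff Lp_nrm_le_iff)
      have yL: "scale f y \<in> carrier ?L" "nrm ?L (scale f y) \<le> 1"
        using below[OF y yF] y f p by (auto simp: in_Lp_iff Lp_nrm_le_iff)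
      have dL: "scale f x \<ominus>\<^bsub>?L\<^esub> scale f y = scale f d"
        using Lp_diff[OF xL(1) yL(1)] scale_diff[OF f x y] by (simp add: d_def)
      have sL: "scale f x \<oplus>\<^bsub>?L\<^esub> scale f y = scale f s"
        using scale_add[OF f x y] by (simp add: s_def Lp_add)
      have "\<epsilon> powr p \<le> pmoment p (scale f d)"
        using above[OF d _ _ i_d, of \<epsilon>] \<epsilon> by (auto simp: F_def)
      then have "\<epsilon> \<le> nrm ?L (scale f x \<ominus>\<^bsub>?L\<^esub> scale f y)"
        unfolding dL using \<epsilon> p d f by (simp add: le_Lp_nrm_iff)
      then have "nrm ?L (scale f s) \<le> 2 * (1 - \<delta>)"
        using conv[OF xL(1) yL(1) xL(2) yL(2)] by (simp add: sL)
      then have up: "pmoment p (scale f s) \<le> (2 * (1 - \<delta>)) powr p"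
        using \<delta> p s f by (subst (asm) Lp_nrm_le_iff) auto
      \<comment> \<open>On \<open>F\<close> the norm of the sum exceeds \<open>2 * (1 - \<delta>)\<close> strictly, so its mean power does too.\<close>
      define h where "h = (\<lambda>w. pnorm (scale f s) w powr p - indicator F w * (2 * (1 - \<delta>)) powr p / prob F)"
      have ih: "integrable M h" unfolding h_def using i_s iF by (intro Bochner_Integration.integrable_diff)
      have h: "AE w in M. 0 \<le> h w \<and> (w \<in> F \<longrightarrow> 0 < h w)"
        using loc(2)[OF s]
      proof eventually_elim
        case (elim w)
        have "(2 * (1 - \<delta>)) powr p < pnorm s w powr p" if "w \<in> F"
          using that \<delta> p by (intro powr_less_mono2) (auto simp: F_def)
        then show ?case using elim PF
          by (auto simp: h_def indicator_def divide_strict_right_mono less_imp_le)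
      qed
      have "(\<integral>w. h w \<partial>M) = pmoment p (scale f s) - (2 * (1 - \<delta>)) powr p"
        unfolding h_def pmoment_def using i_s iF intF by (subst Bochner_Integration.integral_diff) auto
      moreover have "0 \<le> (\<integral>w. h w \<partial>M)" using h by (intro integral_nonneg_AE) auto
      ultimately have "(\<integral>w. h w \<partial>M) = 0" using up by linarith
      then have "AE w in M. h w = 0" using integral_nonneg_eq_0_iff_AE[OF ih] h by auto
      with h have "AE w in M. w \<notin> F" by eventually_elim auto
      then have "prob F = 0" using F by (simp add: prob_eq_0)
      then show False using PF by simp
    qed
    then have "prob F = 0" by (simp add: zero_less_measure_iff)
    then have "AE w in M. w \<notin> F" using F by (simp add: prob_eq_0)
    then show "AE w in M. \<epsilon> \<le> pnorm (x \<ominus>\<^bsub>S\<^esub> y) w \<longrightarrow> pnorm (x \<oplus>\<^bsub>S\<^esub> y) w \<le> 2 * (1 - \<delta>)"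
      using AE_space by eventually_elim (auto simp: F_def s_def d_def)
  qed
qed

lemma (in random_normed_module) random_uniformly_convex_iff_Lp:
  "random_uniformly_convex M S \<longleftrightarrow> (\<forall>p>1. uniformly_convex (Lp_space M S p))"
  using uniformly_convex_Lp random_uniformly_convex_if_Lp[of 2] by auto

theorem theorem1p3:
  fixes M :: "'w measure"
    and S :: "('w, real, 's) rn_module"
    and T :: "('w, complex, 't) rn_module"
  shows "(complete_random_normed_module M S \<longrightarrow>
           (random_uniformly_convex M S \<longleftrightarrow> (\<forall>p>1. uniformly_convex (Lp_space M S p)))) \<and>
         (complete_random_normed_module M T \<longrightarrow>
           (random_uniformly_convex M T \<longleftrightarrow> (\<forall>p>1. uniformly_convex (Lp_space M T p))))"
  by (intro conjI impI random_normed_module.random_uniformly_convex_iff_Lp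
      complete_random_normed_module.axioms(1))

end
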